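(* Let $H$ be a connected involutive graph and let $d\geq D_\mathcal{R}(H)$ be an integer. Assume that Gentle has a winning strategy with $d$ colors in the distinguishing game on $H$ when Rascal moves first, such that every final coloring $c$ produced by this strategy has block-list $L_c(H)$ in a fixed set $\mathcal L$. If $F$ is a connected graph relatively prime to $H$ with $$D(F)\leq \binom{\frac{|V(H)|}{2}+\lfloor\frac d2\rfloor}{\lfloor\frac d2\rfloor}-|\mathcal L|+1,$$ then $D_\mathcal{R}(H\square F)\leq d$.
   Context: All graphs are finite and simple; $\square$ is the Cartesian product, and two graphs are relatively prime if they share no non-trivial Cartesian factor. $D(X)$ is the least number of colors in a distinguishing coloring of $X$ (a coloring whose only color-preserving automorphism is the identity). An involutive graph is a graph $H$ with a map $u\mapsto\overline u$ on $V(H)$ satisfying $\overline{\overline u}=u$, $\overline u\neq u$, and $\sigma(\overline u)=\overline{\sigma(u)}$ for every automorphism $\sigma$ of $H$; the sets $\{u,\overline u\}$ are called blocks. For a coloring $c:V(H)\to\{1,\dots,d\}$, the type of a block $\{u,\overline u\}$ is $c(u)-c(\overline u)\bmod d$ if this residue lies in $\{0,\dots,\lfloor d/2\rfloor\}$, and $c(\overline u)-c(u)\bmod d$ otherwise. The block-list $L_c(H)$ is $(n_0,\dots,n_{\lfloor d/2\rfloor})$ where $n_i$ is the number of blocks of type $i$. The distinguishing game on $X$ with $d$ colors: Gentle and Rascal alternately choose an uncolored vertex and color it with one of the $d$ colors; when all vertices are colored, Gentle wins iff the coloring is distinguishing. $D_\mathcal{R}(X)$ is the least $d$ such that Gentle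 has a winning strategy with $d$ colors when Rascal moves first ($\infty$ if none). *)

theory Defs
  imports "Graph_Theory.Digraph_Component" "HOL-Library.Extended_Nat"
begin

text \<open>Finite simple graphs are the records satisfying \<^locale>\<open>pair_graph\<close>; an edge is a symmetric
  pair of arcs.\<close>

definition cartesian_product ::
    "'a pair_pre_digraph \<Rightarrow> 'b pair_pre_digraph \<Rightarrow> ('a \<times> 'b) pair_pre_digraph" (infixr "\<square>" 75)
  where
  "G \<square> H = \<lparr> pverts = pverts G \<times> pverts H,
     parcs = {((u, x), (v, y)) | u x v y.
       (u = v \<and> u \<in> pverts G \<and> (x, y) \<in> parcs H) \<or>
       (x = y \<and> x \<in> pverts H \<and> (u, v) \<in> parcs G)} \<rparr>"

lemma pair_graph_cartesian_product:
  assumes "pair_graph G" and "pair_graph H"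
  shows "pair_graph (G \<square> H)"
proof -
  interpret G: pair_graph G by fact
  interpret H: pair_graph H by fact
  have "sym (parcs G)" "sym (parcs H)"
    using G.sym_arcs H.sym_arcs by (auto simp: symmetric_def)
  then have "sym (parcs (G \<square> H))"
    by (auto simp: cartesian_product_def sym_def)
  moreover have sub: "parcs (G \<square> H) \<subseteq> pverts (G \<square> H) \<times> pverts (G \<square> H)"
    by (auto simp: cartesian_product_def dest: G.wellformed' H.wellformed')
  moreover have fin: "finite (pverts (G \<square> H))"
    using G.pair_finite_verts H.pair_finite_verts by (simp add: cartesian_product_def)
  moreover have "finite (parcs (G \<square> H))"
    using finite_subset[OF sub] fin by blast
  moreover have "e \<in> parcs (G \<square> H) \<Longrightarrow> fst e \<noteq> snd e" for e
    by (auto simp: cartesian_product_def dest: G.pair_no_loops H.pair_no_loops)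
  ultimately show ?thesis
    by unfold_locales (auto simp: symmetric_def)
qed

text \<open>The values of an isomorphism outside the vertex set are irrelevant.\<close>

definition graph_isomorphism ::
    "'a pair_pre_digraph \<Rightarrow> 'b pair_pre_digraph \<Rightarrow> ('a \<Rightarrow> 'b) \<Rightarrow> bool" where
  "graph_isomorphism G H f \<longleftrightarrow> bij_betw f (pverts G) (pverts H) \<and>
     (\<forall>u \<in> pverts G. \<forall>v \<in> pverts G. (u, v) \<in> parcs G \<longleftrightarrow> (f u, f v) \<in> parcs H)"

abbreviation graph_automorphism :: "'a pair_pre_digraph \<Rightarrow> ('a \<Rightarrow> 'a) \<Rightarrow> bool" where
  "graph_automorphism G \<equiv> graph_isomorphism G G"

text \<open>Every finite graph is isomorphic to one with vertices in \<^typ>\<open>nat\<close>, so it is no loss that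
  factors and cofactors range over such graphs.\<close>

definition cartesian_factor :: "nat pair_pre_digraph \<Rightarrow> 'a pair_pre_digraph \<Rightarrow> bool" where
  "cartesian_factor A G \<longleftrightarrow> pair_graph A \<and>
     (\<exists>(B :: nat pair_pre_digraph) f. pair_graph B \<and> graph_isomorphism (A \<square> B) G f)"

definition relatively_prime :: "'a pair_pre_digraph \<Rightarrow> 'b pair_pre_digraph \<Rightarrow> bool" where
  "relatively_prime G H \<longleftrightarrow>
     \<not> (\<exists>A. card (pverts A) > 1 \<and> cartesian_factor A G \<and> cartesian_factor A H)"

definition distinguishing :: "'a pair_pre_digraph \<Rightarrow> ('a \<Rightarrow> nat) \<Rightarrow> bool" where
  "distinguishing G c \<longleftrightarrow>
     (\<forall>\<sigma>. graph_automorphism G \<sigma> \<and> (\<forall>v \<in> pverts G. c (\<sigma> v) = c v) \<longrightarrow> (\<forall>v \<in> pverts G. \<sigma> v = v))"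

definition distinguishing_number :: "'a pair_pre_digraph \<Rightarrow> nat" where
  "distinguishing_number G = (LEAST d. \<exists>c. c ` pverts G \<subseteq> {1..d} \<and> distinguishing G c)"

definition involutive :: "'a pair_pre_digraph \<Rightarrow> ('a \<Rightarrow> 'a) \<Rightarrow> bool" where
  "involutive H bar \<longleftrightarrow>
     (\<forall>u \<in> pverts H. bar u \<in> pverts H \<and> bar (bar u) = u \<and> bar u \<noteq> u) \<and>
     (\<forall>\<sigma>. graph_automorphism H \<sigma> \<longrightarrow> (\<forall>u \<in> pverts H. \<sigma> (bar u) = bar (\<sigma> u)))"

text \<open>The type of a block whose two vertices have colors \<open>a\<close> and \<open>b\<close>, with \<open>d\<close> colors in total.\<close>

definition block_type :: "nat \<Rightarrow> nat \<Rightarrow> nat \<Rightarrow> nat" where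
  "block_type d a b =
     (let r = (int a - int b) mod int d
      in if r \<in> {0..int (d div 2)} then nat r else nat ((int b - int a) mod int d))"

lemma block_type_commute:
  assumes "d > 0"
  shows "block_type d a b = block_type d b a"
proof -
  define r s where "r = (int a - int b) mod int d" and "s = (int b - int a) mod int d"
  have s: "s = (if r = 0 then 0 else int d - r)"
    unfolding r_def s_def using zmod_zminus1_eq_if[of "int a - int b" "int d"] by simp
  have r: "0 \<le> r" "r < int d"
    using assms by (auto simp: r_def)
  show ?thesis
    unfolding block_type_def Let_def r_def[symmetric] s_def[symmetric]
    using s r by (auto split: if_splits)
qed

definition block_list :: "'a pair_pre_digraph \<Rightarrow> ('a \<Rightarrow> 'a) \<Rightarrow> nat \<Rightarrow> ('a \<Rightarrow> nat) \<Rightarrow> nat list" where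
  "block_list H bar d c =
     map (\<lambda>i. card {{u, bar u} | u. u \<in> pverts H \<and> block_type d (c u) (c (bar u)) = i})
       [0..<d div 2 + 1]"

text \<open>A history lists the moves made so far, oldest first. Rascal moves first, so he is to move after
  an even number of moves. A strategy for Gentle may depend on the whole history.\<close>

type_synonym 'a history = "('a \<times> nat) list"

type_synonym 'a strategy = "'a history \<Rightarrow> 'a \<times> nat"

definition legal_moves :: "'a pair_pre_digraph \<Rightarrow> nat \<Rightarrow> 'a history \<Rightarrow> ('a \<times> nat) set" where
  "legal_moves G d h = (pverts G - fst ` set h) \<times> {1..d}"

definition complete :: "'a pair_pre_digraph \<Rightarrow> 'a history \<Rightarrow> bool" where
  "complete G h \<longleftrightarrow> pverts G \<subseteq> fst ` set h"

inductive_set histories :: "'a pair_pre_digraph \<Rightarrow> nat \<Rightarrow> 'a strategy \<Rightarrow> 'a history set"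
  for G :: "'a pair_pre_digraph" and d :: nat and s :: "'a strategy" where
  start: "[] \<in> histories G d s"
| rascal: "h \<in> histories G d s \<Longrightarrow> even (length h) \<Longrightarrow> m \<in> legal_moves G d h \<Longrightarrow>
    h @ [m] \<in> histories G d s"
| gentle: "h \<in> histories G d s \<Longrightarrow> odd (length h) \<Longrightarrow> s h \<in> legal_moves G d h \<Longrightarrow>
    h @ [s h] \<in> histories G d s"

definition final_colorings :: "'a pair_pre_digraph \<Rightarrow> nat \<Rightarrow> 'a strategy \<Rightarrow> ('a \<Rightarrow> nat) set" where
  "final_colorings G d s = {\<lambda>v. the (map_of h v) | h. h \<in> histories G d s \<and> complete G h}"

text \<open>The first conjunct says that the strategy always supplies a legal move when it is Gentle's
  turn; without it, an illegal strategy would win by never finishing the game.\<close>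

definition winning_strategy :: "'a pair_pre_digraph \<Rightarrow> nat \<Rightarrow> 'a strategy \<Rightarrow> bool" where
  "winning_strategy G d s \<longleftrightarrow>
     (\<forall>h \<in> histories G d s. odd (length h) \<and> \<not> complete G h \<longrightarrow> s h \<in> legal_moves G d h) \<and>
     (\<forall>c \<in> final_colorings G d s. distinguishing G c)"

text \<open>With no colors at all the game cannot be played and every strategy wins vacuously; hence the
  restriction to \<open>d > 0\<close>. The infimum of the empty set is \<open>\<infinity>\<close>.\<close>

definition rascal_game_number :: "'a pair_pre_digraph \<Rightarrow> enat" where
  "rascal_game_number G = Inf {enat d | d. d > 0 \<and> (\<exists>s. winning_strategy G d s)}"

end

theory Submission
  imports Defs
begin

text \<open>Fix a distinguishing coloring \<open>c0\<close> of \<open>F\<close> with \<open>D(F)\<close> colors. Gentle always answers in the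
  \<open>H\<close>-fiber in which Rascal has just played, which is possible because \<open>|V(H)|\<close> is even. In the fibers
  over one chosen color class of \<open>c0\<close> she follows the given strategy; in every other fiber she answers
  inside the block of Rascal's move, which lets her realize any block-list, and she assigns to each
  remaining color of \<open>c0\<close> its own block-list outside \<open>\<L>\<close>. Since \<open>H\<close> and \<open>F\<close> are connected and
  relatively prime, an automorphism of \<open>H \<square> F\<close> is a product of automorphisms \<open>\<sigma>\<close> of \<open>H\<close> and \<open>\<tau>\<close> of
  \<open>F\<close>. If it preserves the final coloring, then \<open>\<sigma>\<close> carries the block-list over \<open>x\<close> to the one over
  \<open>\<tau> x\<close>, so \<open>\<tau>\<close> preserves \<open>c0\<close> and is the identity; a fiber over the chosen color class then
  forces \<open>\<sigma>\<close> to be the identity.\<close>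

section \<open>Automorphisms of Cartesian products of relatively prime graphs\<close>

lemma pair_graph_iff:
  "pair_graph G \<longleftrightarrow> finite (pverts G) \<and> parcs G \<subseteq> pverts G \<times> pverts G \<and> sym (parcs G) \<and>
     (\<forall>v. (v, v) \<notin> parcs G)" (is "_ \<longleftrightarrow> ?R")
proof
  assume "pair_graph G"
  then interpret pair_graph G .
  show ?R
    using pair_finite_verts sym_arcs by (auto simp: symmetric_def wellformed' dest: pair_no_loops)
next
  assume R: ?R
  then have "finite (parcs G)"
    by (meson finite_SigmaI finite_subset)
  then show "pair_graph G"
    using R by unfold_locales (auto simp: symmetric_def)
qed

text \<open>The library notion takes the symmetric closure of the arcs and confines paths to the
  vertex set. Neither changes anything here, since arcs are symmetric and end in vertices. Walks can
  then be handled as powers of the arc relation.\<close>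

lemma connected_iff_rtrancl:
  assumes "pair_graph G"
  shows "Digraph_Component.connected (with_proj G) \<longleftrightarrow>
    pverts G \<noteq> {} \<and> (\<forall>u \<in> pverts G. \<forall>v \<in> pverts G. (u, v) \<in> (parcs G)\<^sup>*)"
proof -
  interpret pair_graph G by fact
  have "(parcs G)\<^sup>s = parcs G"
    using assms by (auto simp: pair_graph_iff symcl_def sym_def)
  moreover have "(u, v) \<in> rtrancl_on (pverts G) (parcs G)"
    if "u \<in> pverts G" "(u, v) \<in> (parcs G)\<^sup>*" for u v
    using that(2,1)
  proof (induction rule: rtrancl_induct)
    case (step y z)
    then show ?case
      using wellformed' by (meson rtrancl_on_into_rtrancl_on)
  qed simp
  moreover have "(u, v) \<in> rtrancl_on (pverts G) (parcs G) \<Longrightarrow> (u, v) \<in> (parcs G)\<^sup>*" for u v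
    by (rule rtrancl_on_rtranclI)
  ultimately show ?thesis
    unfolding connected_conv with_proj_simps by metis
qed

definition connected_graph :: "'a pair_pre_digraph \<Rightarrow> bool" where
  "connected_graph G \<longleftrightarrow> pair_graph G \<and> pverts G \<noteq> {} \<and>
     (\<forall>u \<in> pverts G. \<forall>v \<in> pverts G. (u, v) \<in> (parcs G)\<^sup>*)"

lemma connected_graphI:
  "pair_graph G \<Longrightarrow> Digraph_Component.connected (with_proj G) \<Longrightarrow> connected_graph G"
  by (simp add: connected_graph_def connected_iff_rtrancl)

lemma connected_graph_pair_graph: "connected_graph G \<Longrightarrow> pair_graph G"
  by (simp add: connected_graph_def)

section \<open>Walks and distances in Cartesian products\<close>

lemma pverts_cartesian_product: "pverts (G \<square> H) = pverts G \<times> pverts H"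
  by (simp add: cartesian_product_def)

lemma arc_cartesian_product_iff:
  "((u, x), (v, y)) \<in> parcs (G \<square> H) \<longleftrightarrow>
     (u = v \<and> u \<in> pverts G \<and> (x, y) \<in> parcs H) \<or> (x = y \<and> x \<in> pverts H \<and> (u, v) \<in> parcs G)"
  by (auto simp: cartesian_product_def)

lemma relpow_parcs_in_pverts:
  assumes "pair_graph G" "u \<in> pverts G" "(u, v) \<in> parcs G ^^ n"
  shows "v \<in> pverts G"
  using assms by (cases n) (auto simp: pair_graph_iff)

text \<open>A product arc moves one coordinate and fixes the other, so a walk projects to walks in
  both factors whose lengths add up. Conversely, one walks along \<open>G\<close> first and then
  along \<open>H\<close>.\<close>

lemma relpow_cartesian_product_iff:
  assumes "pair_graph G" "pair_graph H" "u \<in> pverts G" "x \<in> pverts H"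
  shows "((u, x), (v, y)) \<in> parcs (G \<square> H) ^^ n \<longleftrightarrow>
    (\<exists>i j. n = i + j \<and> (u, v) \<in> parcs G ^^ i \<and> (x, y) \<in> parcs H ^^ j)"
proof
  show "\<exists>i j. n = i + j \<and> (u, v) \<in> parcs G ^^ i \<and> (x, y) \<in> parcs H ^^ j"
    if "((u, x), (v, y)) \<in> parcs (G \<square> H) ^^ n"
    using that
  proof (induction n arbitrary: v y)
    case 0
    then show ?case by auto
  next
    case (Suc n)
    then obtain v' y' where step: "((u, x), (v', y')) \<in> parcs (G \<square> H) ^^ n"
      "((v', y'), (v, y)) \<in> parcs (G \<square> H)"
      by auto
    obtain i j where ij: "n = i + j" "(u, v') \<in> parcs G ^^ i" "(x, y') \<in> parcs H ^^ j"
      using Suc.IH[OF step(1)] by blast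
    from step(2) consider "v' = v" "(y', y) \<in> parcs H" | "y' = y" "(v', v) \<in> parcs G"
      by (auto simp: arc_cartesian_product_iff)
    then show ?case
    proof cases
      case 1
      then show ?thesis using ij by (intro exI[of _ i] exI[of _ "Suc j"]) auto
    next
      case 2
      then show ?thesis using ij by (intro exI[of _ "Suc i"] exI[of _ j]) auto
    qed
  qed
next
  assume "\<exists>i j. n = i + j \<and> (u, v) \<in> parcs G ^^ i \<and> (x, y) \<in> parcs H ^^ j"
  then obtain i j where ij: "n = i + j" "(u, v) \<in> parcs G ^^ i" "(x, y) \<in> parcs H ^^ j"
    by blast
  have "((u, x), (v, x)) \<in> parcs (G \<square> H) ^^ i"
    using ij(2)
  proof (induction i arbitrary: v)
    case (Suc i)
    then show ?case
      using assms(4) by (auto simp: arc_cartesian_product_iff intro!: relcompI)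
  qed simp
  \<comment> \<open>A product arc along \<open>H\<close> requires its fixed first coordinate to be a
    vertex.\<close>
  moreover have "v \<in> pverts G"
    using relpow_parcs_in_pverts[OF assms(1,3) ij(2)] .
  then have "((v, x), (v, y)) \<in> parcs (G \<square> H) ^^ j"
    using ij(3)
  proof (induction j arbitrary: y)
    case (Suc j)
    then show ?case
      by (auto simp: arc_cartesian_product_iff intro!: relcompI)
  qed simp
  ultimately show "((u, x), (v, y)) \<in> parcs (G \<square> H) ^^ n"
    unfolding ij(1) relpow_add by blast
qed

lemma connected_graph_cartesian_product:
  assumes "connected_graph G" "connected_graph H"
  shows "connected_graph (G \<square> H)"
proof -
  have pg: "pair_graph G" "pair_graph H"
    using assms by (simp_all add: connected_graph_def)
  have "((u, x), (v, y)) \<in> (parcs (G \<square> H))\<^sup>*"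
    if "u \<in> pverts G" "v \<in> pverts G" "x \<in> pverts H" "y \<in> pverts H" for u v x y
  proof -
    have "(u, v) \<in> (parcs G)\<^sup>*" "(x, y) \<in> (parcs H)\<^sup>*"
      using assms that by (auto simp: connected_graph_def)
    then show ?thesis
      using relpow_cartesian_product_iff[OF pg that(1,3)] by (metis rtrancl_power)
  qed
  then show ?thesis
    using assms pair_graph_cartesian_product[OF pg]
    by (auto simp: connected_graph_def pverts_cartesian_product)
qed

text \<open>Unspecified when no walk exists, so lemmas that need a shortest walk assume
  connectedness.\<close>

definition graph_dist :: "'a pair_pre_digraph \<Rightarrow> 'a \<Rightarrow> 'a \<Rightarrow> nat" where
  "graph_dist G u v = (LEAST n. (u, v) \<in> parcs G ^^ n)"

lemma graph_dist_relpow: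
  assumes "connected_graph G" "u \<in> pverts G" "v \<in> pverts G"
  shows "(u, v) \<in> parcs G ^^ graph_dist G u v"
proof -
  have "\<exists>n. (u, v) \<in> parcs G ^^ n"
    using assms by (auto simp: connected_graph_def rtrancl_power)
  then show ?thesis
    unfolding graph_dist_def by (rule LeastI_ex)
qed

lemma graph_dist_le: "(u, v) \<in> parcs G ^^ n \<Longrightarrow> graph_dist G u v \<le> n"
  unfolding graph_dist_def by (rule Least_le)

lemma graph_dist_refl [simp]: "graph_dist G u u = 0"
  using graph_dist_le[of u u 0 G] by simp

lemma graph_dist_eq_0:
  assumes "connected_graph G" "u \<in> pverts G" "v \<in> pverts G" "graph_dist G u v = 0"
  shows "u = v"
  using graph_dist_relpow[OF assms(1-3)] assms(4) by simp

lemma graph_dist_triangle: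
  assumes "connected_graph G" "u \<in> pverts G" "v \<in> pverts G" "w \<in> pverts G"
  shows "graph_dist G u w \<le> graph_dist G u v + graph_dist G v w"
  using graph_dist_relpow[OF assms(1-3)] graph_dist_relpow[OF assms(1,3,4)]
  by (intro graph_dist_le) (auto simp: relpow_add)

lemma graph_dist_cartesian_product:
  assumes "connected_graph G" "connected_graph H"
    and "u \<in> pverts G" "v \<in> pverts G" "x \<in> pverts H" "y \<in> pverts H"
  shows "graph_dist (G \<square> H) (u, x) (v, y) = graph_dist G u v + graph_dist H x y"
proof (rule antisym)
  note iff = relpow_cartesian_product_iff[OF assms(1,2)[THEN connected_graph_pair_graph] assms(3,5)]
  show "graph_dist (G \<square> H) (u, x) (v, y) \<le> graph_dist G u v + graph_dist H x y"
    using graph_dist_relpow[OF assms(1,3,4)] graph_dist_relpow[OF assms(2,5,6)]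
    by (intro graph_dist_le) (auto simp: iff)
  have "((u, x), (v, y)) \<in> parcs (G \<square> H) ^^ graph_dist (G \<square> H) (u, x) (v, y)"
    using assms
    by (intro graph_dist_relpow connected_graph_cartesian_product)
      (auto simp: pverts_cartesian_product)
  then obtain i j where "graph_dist (G \<square> H) (u, x) (v, y) = i + j"
    "(u, v) \<in> parcs G ^^ i" "(x, y) \<in> parcs H ^^ j"
    by (auto simp: iff)
  then show "graph_dist G u v + graph_dist H x y \<le> graph_dist (G \<square> H) (u, x) (v, y)"
    by (auto intro!: add_mono graph_dist_le)
qed

section \<open>Convex vertex sets\<close>

text \<open>In a connected graph this is geodesic convexity: equality in the triangle inequality
  says that \<open>w\<close> lies on a shortest path from \<open>u\<close> to \<open>v\<close>. The
  metric form transfers along isomorphisms without any handling of paths.\<close>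

definition convex_vertices :: "'a pair_pre_digraph \<Rightarrow> 'a set \<Rightarrow> bool" where
  "convex_vertices G W \<longleftrightarrow> W \<subseteq> pverts G \<and>
     (\<forall>u \<in> W. \<forall>v \<in> W. \<forall>w \<in> pverts G.
        graph_dist G u w + graph_dist G w v = graph_dist G u v \<longrightarrow> w \<in> W)"

text \<open>In the product metric, \<open>(u, y)\<close> always lies between \<open>(u, x)\<close> and \<open>(v, y)\<close>.\<close>

lemma convex_vertices_box:
  assumes "connected_graph G" "connected_graph H" "convex_vertices (G \<square> H) W"
  shows "W = fst ` W \<times> snd ` W"
proof -
  have "(u, y) \<in> W" if "(u, x) \<in> W" "(v, y) \<in> W" for u v x y
  proof -
    have "u \<in> pverts G" "v \<in> pverts G" "x \<in> pverts H" "y \<in> pverts H"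
      using that assms(3) by (auto simp: convex_vertices_def pverts_cartesian_product)
    then show ?thesis
      using that assms(3) graph_dist_cartesian_product[OF assms(1,2)]
      unfolding convex_vertices_def pverts_cartesian_product
      by (metis SigmaI add.commute add_0 graph_dist_refl)
  qed
  then show ?thesis
    by force
qed

text \<open>A vertex \<open>(w, y)\<close> between two vertices of the layer adds the way from
  \<open>x\<close> to \<open>y\<close> and back to a detour in \<open>G\<close> that is already at
  least as long as the direct distance. Hence that way has length 0.\<close>

lemma convex_vertices_layer:
  assumes "connected_graph G" "connected_graph H" "x \<in> pverts H"
  shows "convex_vertices (G \<square> H) (pverts G \<times> {x})"
  unfolding convex_vertices_def
proof (intro conjI ballI impI)
  show "pverts G \<times> {x} \<subseteq> pverts (G \<square> H)"
    using assms by (auto simp: pverts_cartesian_product)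
next
  fix p q r
  assume pqr: "p \<in> pverts G \<times> {x}" "q \<in> pverts G \<times> {x}" "r \<in> pverts (G \<square> H)"
    and eq: "graph_dist (G \<square> H) p r + graph_dist (G \<square> H) r q = graph_dist (G \<square> H) p q"
  obtain u v where uv [simp]: "p = (u, x)" "q = (v, x)"
    using pqr(1,2) by (metis SigmaE singletonD)
  obtain w y where wy [simp]: "r = (w, y)"
    by (cases r)
  have mem: "u \<in> pverts G" "v \<in> pverts G" "w \<in> pverts G" "y \<in> pverts H"
    using pqr by (simp_all add: pverts_cartesian_product)
  have "graph_dist H x y = 0"
    using eq mem assms graph_dist_triangle[OF assms(1), of u w v]
    by (simp add: graph_dist_cartesian_product)
  then have "x = y"
    by (rule graph_dist_eq_0[OF assms(2,3) mem(4)])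
  then show "r \<in> pverts G \<times> {x}"
    using mem by simp
qed

section \<open>Isomorphisms preserve distances and convexity\<close>

lemma graph_isomorphism_in_pverts:
  "graph_isomorphism G H f \<Longrightarrow> u \<in> pverts G \<Longrightarrow> f u \<in> pverts H"
  by (auto simp: graph_isomorphism_def bij_betw_def)

lemma graph_isomorphism_inj_on:
  "graph_isomorphism G H f \<Longrightarrow> inj_on f (pverts G)"
  by (auto simp: graph_isomorphism_def bij_betw_def)

lemma graph_isomorphism_image:
  "graph_isomorphism G H f \<Longrightarrow> f ` pverts G = pverts H"
  by (auto simp: graph_isomorphism_def bij_betw_def)

lemma graph_isomorphism_inv:
  assumes "graph_isomorphism G H f"
  shows "graph_isomorphism H G (inv_into (pverts G) f)"
proof -
  have bij: "bij_betw f (pverts G) (pverts H)"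
    and arcs: "\<And>u v. u \<in> pverts G \<Longrightarrow> v \<in> pverts G \<Longrightarrow> (u, v) \<in> parcs G \<longleftrightarrow> (f u, f v) \<in> parcs H"
    using assms by (auto simp: graph_isomorphism_def)
  have *: "inv_into (pverts G) f u \<in> pverts G" "f (inv_into (pverts G) f u) = u"
    if "u \<in> pverts H" for u
    using bij that by (auto simp: bij_betw_def inv_into_into f_inv_into_f)
  show ?thesis
    unfolding graph_isomorphism_def
    using bij_betw_inv_into[OF bij] by (auto simp: * arcs)
qed

lemma graph_isomorphism_comp:
  assumes "graph_isomorphism G H f" "graph_isomorphism H K g"
  shows "graph_isomorphism G K (g \<circ> f)"
  using assms graph_isomorphism_in_pverts[OF assms(1)]
  by (auto simp: graph_isomorphism_def intro: bij_betw_trans)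

lemma graph_isomorphism_relpow:
  assumes "pair_graph G" "graph_isomorphism G H f" "u \<in> pverts G" "(u, v) \<in> parcs G ^^ n"
  shows "(f u, f v) \<in> parcs H ^^ n"
  using assms(4)
proof (induction n arbitrary: v)
  case (Suc n)
  then obtain w where w: "(u, w) \<in> parcs G ^^ n" "(w, v) \<in> parcs G"
    by auto
  then have "w \<in> pverts G" "v \<in> pverts G"
    using assms(1) by (auto simp: pair_graph_iff)
  then have "(f w, f v) \<in> parcs H"
    using assms(2) w(2) by (auto simp: graph_isomorphism_def)
  then show ?case
    using Suc.IH[OF w(1)] by auto
qed simp

text \<open>Walks keep their length under \<open>f\<close> and under its inverse.\<close>

lemma graph_isomorphism_dist:
  assumes "connected_graph G" "connected_graph H" "graph_isomorphism G H f"
    and "u \<in> pverts G" "v \<in> pverts G"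
  shows "graph_dist H (f u) (f v) = graph_dist G u v"
proof (rule antisym)
  have pg: "pair_graph G" "pair_graph H"
    using assms by (simp_all add: connected_graph_def)
  have f: "f u \<in> pverts H" "f v \<in> pverts H"
    using graph_isomorphism_in_pverts[OF assms(3)] assms by auto
  show "graph_dist H (f u) (f v) \<le> graph_dist G u v"
    by (intro graph_dist_le graph_isomorphism_relpow[OF pg(1) assms(3,4)]
        graph_dist_relpow[OF assms(1,4,5)])
  have "(inv_into (pverts G) f (f u), inv_into (pverts G) f (f v))
      \<in> parcs G ^^ graph_dist H (f u) (f v)"
    by (intro graph_isomorphism_relpow[OF pg(2) graph_isomorphism_inv[OF assms(3)] f(1)]
        graph_dist_relpow[OF assms(2) f])
  then show "graph_dist G u v \<le> graph_dist H (f u) (f v)"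
    using graph_isomorphism_inj_on[OF assms(3)] assms(4,5) by (simp add: graph_dist_le)
qed

lemma graph_isomorphism_convex_vertices:
  assumes "connected_graph G" "connected_graph H" "graph_isomorphism G H f"
    and "convex_vertices G W"
  shows "convex_vertices H (f ` W)"
proof -
  have W: "W \<subseteq> pverts G"
    using assms(4) by (simp add: convex_vertices_def)
  have "f w \<in> f ` W" if "u \<in> W" "v \<in> W" "w \<in> pverts G"
    "graph_dist H (f u) (f w) + graph_dist H (f w) (f v) = graph_dist H (f u) (f v)" for u v w
  proof -
    have "graph_dist G u w + graph_dist G w v = graph_dist G u v"
      using that W graph_isomorphism_dist[OF assms(1-3)] by (metis subsetD)
    then show ?thesis
      using that(1-3) assms(4) unfolding convex_vertices_def by blast
  qed
  note between = this
  show ?thesis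
    unfolding convex_vertices_def
  proof (intro conjI ballI impI)
    show "f ` W \<subseteq> pverts H"
      using W graph_isomorphism_image[OF assms(3)] by blast
    fix p q r
    assume "p \<in> f ` W" "q \<in> f ` W" "r \<in> pverts H"
      and eq: "graph_dist H p r + graph_dist H r q = graph_dist H p q"
    then obtain u v w where "u \<in> W" "p = f u" "v \<in> W" "q = f v" "w \<in> pverts G" "r = f w"
      unfolding graph_isomorphism_image[OF assms(3), symmetric] by (elim imageE)
    then show "r \<in> f ` W"
      using between eq by simp
  qed
qed

section \<open>Induced subgraphs and common factors\<close>

definition vertex_induced :: "'a pair_pre_digraph \<Rightarrow> 'a set \<Rightarrow> 'a pair_pre_digraph" where
  "vertex_induced G W = \<lparr>pverts = W, parcs = parcs G \<inter> W \<times> W\<rparr>"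

lemma vertex_induced_simps [simp]:
  "pverts (vertex_induced G W) = W"
  "parcs (vertex_induced G W) = parcs G \<inter> W \<times> W"
  by (simp_all add: vertex_induced_def)

lemma pair_graph_vertex_induced:
  "pair_graph G \<Longrightarrow> W \<subseteq> pverts G \<Longrightarrow> pair_graph (vertex_induced G W)"
  by (auto simp: pair_graph_iff sym_def intro: finite_subset)

text \<open>Turns a box of vertices into a factorization of the graph that it induces.\<close>

lemma vertex_induced_cartesian_product:
  assumes "U \<subseteq> pverts G" "V \<subseteq> pverts H"
  shows "vertex_induced (G \<square> H) (U \<times> V) = vertex_induced G U \<square> vertex_induced H V"
proof -
  have "parcs (G \<square> H) \<inter> (U \<times> V) \<times> (U \<times> V) = parcs (vertex_induced G U \<square> vertex_induced H V)"
    using assms by (auto simp: cartesian_product_def)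
  then show ?thesis
    by (simp add: cartesian_product_def vertex_induced_def)
qed

lemma graph_isomorphism_swap:
  "graph_isomorphism (G \<square> H) (H \<square> G) prod.swap"
  unfolding graph_isomorphism_def
  by (auto simp: arc_cartesian_product_iff pverts_cartesian_product bij_betw_def)

lemma graph_isomorphism_map_prod:
  assumes "graph_isomorphism G G' f" "graph_isomorphism H H' g"
  shows "graph_isomorphism (G \<square> H) (G' \<square> H') (map_prod f g)"
proof -
  have "bij_betw (map_prod f g) (pverts G \<times> pverts H) (pverts G' \<times> pverts H')"
    using assms bij_betw_map_prod unfolding graph_isomorphism_def by blast
  then show ?thesis
    using assms unfolding graph_isomorphism_def
    by (auto simp: pverts_cartesian_product arc_cartesian_product_iff bij_betw_def inj_on_def)
qed

text \<open>Needed because \<open>cartesian_factor\<close> quantifies over graphs on natural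
  numbers, while factors arise on other vertex types. The copy is the push-forward along an
  injection of the finite vertex set.\<close>

lemma graph_isomorphism_nat:
  fixes G :: "'a pair_pre_digraph"
  assumes "pair_graph G"
  obtains G' :: "nat pair_pre_digraph" and f where "pair_graph G'" "graph_isomorphism G' G f"
proof -
  have "finite (pverts G)"
    using assms by (simp add: pair_graph_iff)
  then obtain f :: "'a \<Rightarrow> nat" where inj: "inj_on f (pverts G)"
    using finite_imp_inj_to_nat_seg by metis
  define G' where "G' = \<lparr>pverts = f ` pverts G, parcs = map_prod f f ` parcs G\<rparr>"
  have wf: "parcs G \<subseteq> pverts G \<times> pverts G"
    using assms by (simp add: pair_graph_iff)
  have arcs: "(f u, f v) \<in> parcs G' \<longleftrightarrow> (u, v) \<in> parcs G" if "u \<in> pverts G" "v \<in> pverts G" for u v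
  proof
    assume "(f u, f v) \<in> parcs G'"
    then obtain a b where ab: "(a, b) \<in> parcs G" "f a = f u" "f b = f v"
      unfolding G'_def by (auto elim!: imageE)
    then have "a \<in> pverts G" "b \<in> pverts G"
      using wf by auto
    then have "a = u" "b = v"
      using that ab(2,3) inj_onD[OF inj] by blast+
    then show "(u, v) \<in> parcs G"
      using ab(1) by simp
  qed (simp add: G'_def rev_image_eqI)
  have "graph_isomorphism G G' f"
    using inj arcs by (auto simp: graph_isomorphism_def bij_betw_def G'_def)
  moreover have "pair_graph G'"
    unfolding pair_graph_iff
  proof (intro conjI)
    show "sym (parcs G')"
      using assms by (force simp: pair_graph_iff sym_def G'_def)
    show "\<forall>v. (v, v) \<notin> parcs G'"
    proof (intro allI notI)
      fix v assume "(v, v) \<in> parcs G'"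
      then obtain a b where "(a, b) \<in> parcs G" "f a = v" "f b = v"
        by (auto simp: G'_def)
      moreover from this have "a = b"
        using wf inj_onD[OF inj, of a b] by auto
      ultimately show False
        using assms by (auto simp: pair_graph_iff)
    qed
  qed (use assms wf in \<open>auto simp: pair_graph_iff G'_def\<close>)
  ultimately show ?thesis
    using that graph_isomorphism_inv by metis
qed

lemma cartesian_factorI:
  assumes "pair_graph A" "graph_isomorphism A X f" "pair_graph Y" "graph_isomorphism (X \<square> Y) G g"
  shows "cartesian_factor A G"
proof -
  obtain B :: "nat pair_pre_digraph" and h where B: "pair_graph B" "graph_isomorphism B Y h"
    using graph_isomorphism_nat[OF assms(3)] .
  have "graph_isomorphism (A \<square> B) G (g \<circ> map_prod f h)"
    using graph_isomorphism_comp graph_isomorphism_map_prod assms B by metis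
  then show ?thesis
    using assms(1) B(1) by (auto simp: cartesian_factor_def)
qed

text \<open>One copy of \<open>X\<close> on natural numbers serves as a factor of \<open>G\<close>
  directly and of \<open>H\<close> through \<open>h\<close>. The vertex types of \<open>X\<close>
  and \<open>X'\<close> may differ.\<close>

lemma relatively_prime_common_factor:
  assumes "relatively_prime G H"
    and "pair_graph X" "pair_graph Y" "graph_isomorphism (X \<square> Y) G f"
    and "pair_graph Z" "graph_isomorphism (X' \<square> Z) H g" "graph_isomorphism X X' h"
  shows "card (pverts X) \<le> 1"
proof -
  obtain A :: "nat pair_pre_digraph" and k where A: "pair_graph A" "graph_isomorphism A X k"
    using graph_isomorphism_nat[OF assms(2)] .
  have "cartesian_factor A G"
    using cartesian_factorI[OF A assms(3,4)] .
  moreover have "cartesian_factor A H"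
    using cartesian_factorI[OF A(1) graph_isomorphism_comp[OF A(2) assms(7)] assms(5,6)] .
  moreover have "card (pverts A) = card (pverts X)"
    using A(2) by (auto simp: graph_isomorphism_def dest: bij_betw_same_card)
  ultimately show ?thesis
    using assms(1) unfolding relatively_prime_def by (metis not_le_imp_less)
qed

lemma relatively_prime_commute: "relatively_prime G H \<Longrightarrow> relatively_prime H G"
  by (auto simp: relatively_prime_def)

text \<open>A layer is convex, hence so is its image, which is therefore a box \<open>U \<times> V\<close>; dually, the
  preimage of a fiber over \<open>C\<close> is a box \<open>Q \<times> S\<close>. Both \<open>V\<close> and \<open>Q\<close> describe the intersection of
  these two boxes, so they induce a common factor of \<open>A\<close> and \<open>D\<close>.\<close>

lemma layer_preserved:
  assumes "connected_graph A" "connected_graph B" "connected_graph C" "connected_graph D"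
    and iso: "graph_isomorphism (A \<square> B) (C \<square> D) \<phi>"
    and prime: "relatively_prime A D"
    and a: "a \<in> pverts A" and a': "a' \<in> pverts A" and b: "b \<in> pverts B"
  shows "snd (\<phi> (a, b)) = snd (\<phi> (a', b))"
proof -
  note pg = assms(1-4)[THEN connected_graph_pair_graph]
  have AB: "connected_graph (A \<square> B)" and CD: "connected_graph (C \<square> D)"
    using assms connected_graph_cartesian_product by auto
  define \<psi> where "\<psi> = inv_into (pverts (A \<square> B)) \<phi>"
  have iso': "graph_isomorphism (C \<square> D) (A \<square> B) \<psi>"
    unfolding \<psi>_def using graph_isomorphism_inv[OF iso] .
  have \<phi>_in: "\<phi> p \<in> pverts C \<times> pverts D" if "p \<in> pverts A \<times> pverts B" for p
    using graph_isomorphism_in_pverts[OF iso] that by (auto simp: pverts_cartesian_product)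
  have \<psi>_in: "\<psi> p \<in> pverts A \<times> pverts B" if "p \<in> pverts C \<times> pverts D" for p
    using graph_isomorphism_in_pverts[OF iso'] that by (auto simp: pverts_cartesian_product)
  have \<phi>\<psi>: "\<phi> (\<psi> p) = p" if "p \<in> pverts C \<times> pverts D" for p
    unfolding \<psi>_def using that graph_isomorphism_image[OF iso]
    by (auto simp: pverts_cartesian_product intro!: f_inv_into_f)
  have \<psi>\<phi>: "\<psi> (\<phi> p) = p" if "p \<in> pverts A \<times> pverts B" for p
    unfolding \<psi>_def using that graph_isomorphism_inj_on[OF iso]
    by (auto simp: pverts_cartesian_product)
  have \<phi>_arc: "(\<phi> p, \<phi> q) \<in> parcs (C \<square> D) \<longleftrightarrow> (p, q) \<in> parcs (A \<square> B)"
    if "p \<in> pverts A \<times> pverts B" "q \<in> pverts A \<times> pverts B" for p q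
    using iso that by (auto simp: graph_isomorphism_def pverts_cartesian_product)
  have \<psi>_arc: "(\<psi> p, \<psi> q) \<in> parcs (A \<square> B) \<longleftrightarrow> (p, q) \<in> parcs (C \<square> D)"
    if "p \<in> pverts C \<times> pverts D" "q \<in> pverts C \<times> pverts D" for p q
    using iso' that by (auto simp: graph_isomorphism_def pverts_cartesian_product)
  have no_loop: "(v, v) \<notin> parcs A" "(w, w) \<notin> parcs B" "(x, x) \<notin> parcs C" "(y, y) \<notin> parcs D"
    for v w x y
    using pg by (auto simp: pair_graph_iff)

  define c where "c = fst (\<phi> (a, b))"
  have c: "c \<in> pverts C"
    using \<phi>_in[of "(a, b)"] a b by (auto simp: c_def)
  \<comment> \<open>\<open>W\<close> lies in \<open>C \<square> D\<close> and is the image of the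
    layer at \<open>b\<close>. \<open>Z\<close> lies in \<open>A \<square> B\<close> and is the
    preimage of the fiber over \<open>c\<close>, the one through the image of
    \<open>(a, b)\<close>.\<close>
  define W where "W = \<phi> ` (pverts A \<times> {b})"
  define Z where "Z = \<psi> ` ({c} \<times> pverts D)"
  define U V where "U = fst ` W" and "V = snd ` W"
  define Q S where "Q = fst ` Z" and "S = snd ` Z"
  have W: "W = U \<times> V"
    unfolding U_def V_def W_def
    using convex_vertices_box graph_isomorphism_convex_vertices[OF AB CD iso]
      convex_vertices_layer assms b by metis
  have "convex_vertices (C \<square> D) ({c} \<times> pverts D)"
  proof -
    \<comment> \<open>\<open>convex_vertices_layer\<close> fixes the second coordinate, so a fiber
      with fixed first coordinate is reached by swapping the factors.\<close>
    have "convex_vertices (C \<square> D) (prod.swap ` (pverts D \<times> {c}))"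
      using graph_isomorphism_convex_vertices[OF _ _ graph_isomorphism_swap]
        convex_vertices_layer connected_graph_cartesian_product assms c by metis
    moreover have "prod.swap ` (pverts D \<times> {c}) = {c} \<times> pverts D"
      by force
    ultimately show ?thesis
      by simp
  qed
  then have Z: "Z = Q \<times> S"
    unfolding Q_def S_def Z_def
    using convex_vertices_box graph_isomorphism_convex_vertices[OF CD AB iso'] assms by metis
  have "W \<subseteq> pverts C \<times> pverts D"
    using \<phi>_in b unfolding W_def by blast
  then have UV: "U \<subseteq> pverts C" "V \<subseteq> pverts D"
    by (auto simp: U_def V_def)
  have "Z \<subseteq> pverts A \<times> pverts B"
    using \<psi>_in c unfolding Z_def by blast
  then have QS: "Q \<subseteq> pverts A" "S \<subseteq> pverts B"
    by (auto simp: Q_def S_def)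
  have Z_iff: "p \<in> Z \<longleftrightarrow> fst (\<phi> p) = c" if "p \<in> pverts A \<times> pverts B" for p
  proof
    assume "p \<in> Z"
    then obtain y where "y \<in> pverts D" "p = \<psi> (c, y)"
      by (auto simp: Z_def)
    then show "fst (\<phi> p) = c"
      using \<phi>\<psi>[of "(c, y)"] c by simp
  next
    assume "fst (\<phi> p) = c"
    then have "\<phi> p \<in> {c} \<times> pverts D"
      using \<phi>_in[OF that] by (cases "\<phi> p") simp
    then show "p \<in> Z"
      unfolding Z_def using \<psi>\<phi>[OF that] by (metis imageI)
  qed
  \<comment> \<open>Since \<open>Z\<close> and \<open>W\<close> are boxes, this puts
    \<open>(v, b)\<close> into \<open>Z\<close> for every \<open>v\<close> in \<open>Q\<close>, and
    \<open>cU\<close> puts \<open>(c, y)\<close> into \<open>W\<close> for every \<open>y\<close> in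
    \<open>V\<close>.\<close>
  have abZ: "(a, b) \<in> Z"
    using Z_iff[of "(a, b)"] a b c_def by simp
  have cU: "c \<in> U"
    using a unfolding U_def W_def c_def by blast

  \<comment> \<open>\<open>A\<close> is a copy of the graph induced on \<open>U \<times> V\<close>,
    so \<open>V\<close> induces a factor of \<open>A\<close>.\<close>
  have isoA: "graph_isomorphism A (vertex_induced (C \<square> D) W) (\<lambda>v. \<phi> (v, b))"
    unfolding graph_isomorphism_def bij_betw_def vertex_induced_simps
  proof (intro conjI ballI)
    show "inj_on (\<lambda>v. \<phi> (v, b)) (pverts A)"
    proof (rule inj_onI)
      fix v w
      assume vw: "v \<in> pverts A" "w \<in> pverts A" "\<phi> (v, b) = \<phi> (w, b)"
      have "(v, b) = \<psi> (\<phi> (v, b))"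
        using \<psi>\<phi>[OF SigmaI[OF vw(1) b]] by simp
      also have "\<dots> = (w, b)"
        unfolding vw(3) using \<psi>\<phi>[OF SigmaI[OF vw(2) b]] .
      finally show "v = w"
        by simp
    qed
    show "(\<lambda>v. \<phi> (v, b)) ` pverts A = W"
      by (auto simp: W_def)
    show "(v, w) \<in> parcs A \<longleftrightarrow> (\<phi> (v, b), \<phi> (w, b)) \<in> parcs (C \<square> D) \<inter> W \<times> W"
      if "v \<in> pverts A" "w \<in> pverts A" for v w
      using \<phi>_arc[of "(v, b)" "(w, b)"] that b no_loop
      by (simp add: arc_cartesian_product_iff W_def)
  qed
  \<comment> \<open>Dually, \<open>D\<close> is a copy of the graph induced on
    \<open>Q \<times> S\<close>, so \<open>Q\<close> induces a factor of \<open>D\<close>.\<close>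
  have isoD: "graph_isomorphism D (vertex_induced (A \<square> B) Z) (\<lambda>y. \<psi> (c, y))"
    unfolding graph_isomorphism_def bij_betw_def vertex_induced_simps
  proof (intro conjI ballI)
    show "inj_on (\<lambda>y. \<psi> (c, y)) (pverts D)"
    proof (rule inj_onI)
      fix y z
      assume yz: "y \<in> pverts D" "z \<in> pverts D" "\<psi> (c, y) = \<psi> (c, z)"
      have "(c, y) = \<phi> (\<psi> (c, y))"
        using \<phi>\<psi>[OF SigmaI[OF c yz(1)]] by simp
      also have "\<dots> = (c, z)"
        unfolding yz(3) using \<phi>\<psi>[OF SigmaI[OF c yz(2)]] .
      finally show "y = z"
        by simp
    qed
    show "(\<lambda>y. \<psi> (c, y)) ` pverts D = Z"
      by (auto simp: Z_def)
    show "(y, z) \<in> parcs D \<longleftrightarrow> (\<psi> (c, y), \<psi> (c, z)) \<in> parcs (A \<square> B) \<inter> Z \<times> Z"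
      if "y \<in> pverts D" "z \<in> pverts D" for y z
      using \<psi>_arc[of "(c, y)" "(c, z)"] that c no_loop
      by (simp add: arc_cartesian_product_iff Z_def)
  qed
  \<comment> \<open>On \<open>Q\<close> the first coordinate of \<open>\<phi> (v, b)\<close> is
    constantly \<open>c\<close>, so adjacency is decided by the second coordinate.\<close>
  have isoQV:
    "graph_isomorphism (vertex_induced A Q) (vertex_induced D V) (\<lambda>v. snd (\<phi> (v, b)))"
  proof -
    have eq: "\<phi> (v, b) = (c, snd (\<phi> (v, b)))" "v \<in> pverts A" if "v \<in> Q" for v
    proof -
      show "v \<in> pverts A"
        using that QS by auto
      moreover have "(v, b) \<in> Z"
        using that abZ unfolding Z by auto
      ultimately show "\<phi> (v, b) = (c, snd (\<phi> (v, b)))"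
        using Z_iff b by (simp add: prod_eq_iff)
    qed
    have inj: "inj_on (\<lambda>v. snd (\<phi> (v, b))) Q"
      using graph_isomorphism_inj_on[OF isoA] eq unfolding inj_on_def by metis
    have "(\<lambda>v. snd (\<phi> (v, b))) ` Q = V"
    proof (intro equalityI subsetI)
      fix y assume "y \<in> V"
      then have "(c, y) \<in> W"
        using cU W by auto
      then obtain v where v: "v \<in> pverts A" "\<phi> (v, b) = (c, y)"
        by (auto simp: W_def)
      then have "(v, b) \<in> Z"
        using Z_iff b by simp
      then show "y \<in> (\<lambda>v. snd (\<phi> (v, b))) ` Q"
        using v by (force simp: Q_def)
    qed (use eq(2) in \<open>auto simp: V_def W_def\<close>)
    moreover have "(snd (\<phi> (v, b)), snd (\<phi> (w, b))) \<in> parcs D \<longleftrightarrow> (v, w) \<in> parcs A"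
      if "v \<in> Q" "w \<in> Q" for v w
    proof -
      have "(\<phi> (v, b), \<phi> (w, b)) \<in> parcs (C \<square> D) \<longleftrightarrow>
          (snd (\<phi> (v, b)), snd (\<phi> (w, b))) \<in> parcs D"
        using eq that c no_loop by (metis arc_cartesian_product_iff)
      moreover have "((v, b), (w, b)) \<in> parcs (A \<square> B) \<longleftrightarrow> (v, w) \<in> parcs A"
        using b no_loop by (auto simp: arc_cartesian_product_iff)
      ultimately show ?thesis
        using \<phi>_arc eq(2) that b by auto
    qed
    ultimately show ?thesis
      using inj by (auto simp: graph_isomorphism_def bij_betw_def)
  qed
  have "card (pverts (vertex_induced D V)) \<le> 1"
  proof (rule relatively_prime_common_factor[OF prime])
    show "pair_graph (vertex_induced D V)" "pair_graph (vertex_induced C U)"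
      "pair_graph (vertex_induced B S)"
      using pair_graph_vertex_induced pg UV QS by auto
    show "graph_isomorphism (vertex_induced D V \<square> vertex_induced C U) A
        (inv_into (pverts A) (\<lambda>v. \<phi> (v, b)) \<circ> prod.swap)"
      using graph_isomorphism_inv[OF isoA]
      unfolding W vertex_induced_cartesian_product[OF UV]
      by (rule graph_isomorphism_comp[OF graph_isomorphism_swap])
    show "graph_isomorphism (vertex_induced A Q \<square> vertex_induced B S) D
        (inv_into (pverts D) (\<lambda>y. \<psi> (c, y)))"
      using graph_isomorphism_inv[OF isoD]
      unfolding Z vertex_induced_cartesian_product[OF QS] .
    show "graph_isomorphism (vertex_induced D V) (vertex_induced A Q)
        (inv_into (pverts (vertex_induced A Q)) (\<lambda>v. snd (\<phi> (v, b))))"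
      using graph_isomorphism_inv[OF isoQV] .
  qed
  \<comment> \<open>Infinite sets have \<open>card\<close> 0, so the bound is informative only for
    finite \<open>V\<close>.\<close>
  moreover have "finite V"
    using UV(2) pg(4) by (auto simp: pair_graph_iff intro: finite_subset)
  ultimately have "is_singleton V \<or> V = {}"
    by (metis card_le_Suc0_iff_eq One_nat_def vertex_induced_simps(1) is_singletonI' )
  moreover have "snd (\<phi> (a, b)) \<in> V" "snd (\<phi> (a', b)) \<in> V"
    using a a' by (auto simp: V_def W_def)
  ultimately show ?thesis
    by (auto simp: is_singleton_def)
qed

text \<open>By \<open>layer_preserved\<close> the second coordinate of the image depends on the
  second argument alone. The same lemma for the swapped product treats the first coordinate.\<close>

lemma automorphism_cartesian_product:
  assumes "connected_graph H" "connected_graph F" "relatively_prime H F"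
    and aut: "graph_automorphism (H \<square> F) \<phi>"
  obtains \<sigma> \<tau> where "graph_automorphism H \<sigma>" "graph_automorphism F \<tau>"
    "\<And>u x. u \<in> pverts H \<Longrightarrow> x \<in> pverts F \<Longrightarrow> \<phi> (u, x) = (\<sigma> u, \<tau> x)"
proof -
  note pg = assms(1,2)[THEN connected_graph_pair_graph]
  obtain u0 x0 where u0: "u0 \<in> pverts H" and x0: "x0 \<in> pverts F"
    using assms(1,2) by (auto simp: connected_graph_def)
  \<comment> \<open>The base vertices freeze the other coordinate. By layer preservation their
    choice does not matter.\<close>
  define \<sigma> \<tau> where "\<sigma> u = fst (\<phi> (u, x0))" and "\<tau> x = snd (\<phi> (u0, x))" for u x
  have snd: "snd (\<phi> (u, x)) = snd (\<phi> (u', x))"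
    if "u \<in> pverts H" "u' \<in> pverts H" "x \<in> pverts F" for u u' x
    using layer_preserved[OF assms(1,2,1,2) aut assms(3) that] .
  have "graph_isomorphism (F \<square> H) (F \<square> H) (prod.swap \<circ> (\<phi> \<circ> prod.swap))"
    using graph_isomorphism_comp graph_isomorphism_swap aut by metis
  note swapped = layer_preserved[OF assms(2,1,2,1) this relatively_prime_commute[OF assms(3)]]
  have fst: "fst (\<phi> (u, x)) = fst (\<phi> (u, x'))"
    if "x \<in> pverts F" "x' \<in> pverts F" "u \<in> pverts H" for u x x'
    using swapped[OF that] by simp
  have eq: "\<phi> (u, x) = (\<sigma> u, \<tau> x)" if "u \<in> pverts H" "x \<in> pverts F" for u x
    using fst[OF that(2) x0 that(1)] snd[OF that(1) u0 that(2)]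
    by (simp add: prod_eq_iff \<sigma>_def \<tau>_def)
  have mem: "\<sigma> u \<in> pverts H" "\<tau> x \<in> pverts F" if "u \<in> pverts H" "x \<in> pverts F" for u x
    using graph_isomorphism_in_pverts[OF aut, of "(u, x)"] that
    by (auto simp: pverts_cartesian_product eq)
  have inj: "u = v \<and> x = y" if "u \<in> pverts H" "x \<in> pverts F" "v \<in> pverts H" "y \<in> pverts F"
    "\<sigma> u = \<sigma> v" "\<tau> x = \<tau> y" for u v x y
    using graph_isomorphism_inj_on[OF aut] that
    by (auto simp: pverts_cartesian_product inj_on_def eq)
  have arc: "((\<sigma> u, \<tau> x), (\<sigma> v, \<tau> y)) \<in> parcs (H \<square> F) \<longleftrightarrow> ((u, x), (v, y)) \<in> parcs (H \<square> F)"
    if "u \<in> pverts H" "x \<in> pverts F" "v \<in> pverts H" "y \<in> pverts F" for u v x y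
    using aut that by (auto simp: graph_isomorphism_def pverts_cartesian_product eq)
  have no_loop: "(v, v) \<notin> parcs H" "(x, x) \<notin> parcs F" for v x
    using pg by (auto simp: pair_graph_iff)
  have fin: "finite (pverts H)" "finite (pverts F)"
    using pg by (auto simp: pair_graph_iff)
  \<comment> \<open>On a finite set an injective self-map is surjective.\<close>
  have "inj_on \<sigma> (pverts H)" "\<sigma> ` pverts H \<subseteq> pverts H"
    using mem inj x0 by (auto intro!: inj_onI)
  then have "bij_betw \<sigma> (pverts H) (pverts H)"
    using endo_inj_surj[OF fin(1)] by (simp add: bij_betw_def)
  moreover have "inj_on \<tau> (pverts F)" "\<tau> ` pverts F \<subseteq> pverts F"
    using mem inj u0 by (auto intro!: inj_onI)
  then have "bij_betw \<tau> (pverts F) (pverts F)"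
    using endo_inj_surj[OF fin(2)] by (simp add: bij_betw_def)
  moreover have "(u, v) \<in> parcs H \<longleftrightarrow> (\<sigma> u, \<sigma> v) \<in> parcs H" if "u \<in> pverts H" "v \<in> pverts H" for u v
    using arc[OF that(1) x0 that(2) x0] mem x0 u0 that
    by (auto simp: arc_cartesian_product_iff no_loop)
  moreover have "(x, y) \<in> parcs F \<longleftrightarrow> (\<tau> x, \<tau> y) \<in> parcs F" if "x \<in> pverts F" "y \<in> pverts F" for x y
    using arc[OF u0 that(1) u0 that(2)] mem x0 u0 that
    by (auto simp: arc_cartesian_product_iff no_loop)
  ultimately show ?thesis
    using that[of \<sigma> \<tau>] eq by (simp add: graph_isomorphism_def)
qed

section \<open>The distinguishing game on a Cartesian product\<close>

text \<open>Remove the pairs \<open>{u, f u}\<close> one at a time. The parity is what lets Gentle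
  stay in the fiber of Rascal's move.\<close>

lemma even_card_involution:
  assumes "finite A" "\<And>u. u \<in> A \<Longrightarrow> f u \<in> A \<and> f (f u) = u \<and> f u \<noteq> u"
  shows "even (card A)"
  using assms
proof (induction A rule: finite_psubset_induct)
  case (psubset A)
  show ?case
  proof (cases "A = {}")
    case False
    then obtain u where u: "u \<in> A" by blast
    define B where "B = A - {u, f u}"
    have fu: "f u \<in> A" "f (f u) = u" "f u \<noteq> u"
      using psubset.prems[OF u] by auto
    have "f v \<in> B \<and> f (f v) = v \<and> f v \<noteq> v" if "v \<in> B" for v
      using psubset.prems[of v] that fu by (auto simp: B_def)
    moreover have "B \<subset> A"
      using u by (auto simp: B_def)
    ultimately have "even (card B)"
      using psubset.IH by blast
    moreover have "card A = card B + card {u, f u}"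
      unfolding B_def using u fu
        card_Diff_subset[of "{u, f u}" A] card_mono[OF psubset(1), of "{u, f u}"] by simp
    ultimately show ?thesis
      using fu by simp
  qed simp
qed

section \<open>Legal strategies and the shape of histories\<close>

text \<open>Separated from winning because in some fibers Gentle uses a strategy that is legal but
  not claimed to win on \<open>H\<close>.\<close>

definition legal_strategy :: "'a pair_pre_digraph \<Rightarrow> nat \<Rightarrow> 'a strategy \<Rightarrow> bool" where
  "legal_strategy G d s \<longleftrightarrow>
     (\<forall>h \<in> histories G d s. odd (length h) \<and> \<not> complete G h \<longrightarrow> s h \<in> legal_moves G d h)"

lemma winning_strategy_iff:
  "winning_strategy G d s \<longleftrightarrow>
     legal_strategy G d s \<and> (\<forall>c \<in> final_colorings G d s. distinguishing G c)"
  by (simp add: winning_strategy_def legal_strategy_def)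

lemma histories_moves:
  assumes "h \<in> histories G d s"
  shows "distinct (map fst h) \<and> fst ` set h \<subseteq> pverts G \<and> snd ` set h \<subseteq> {1..d}"
  using assms by induction (force simp: legal_moves_def)+

text \<open>Positions count from 0, so the odd ones are Gentle's.\<close>

lemma histories_nth_odd:
  assumes "h \<in> histories G d s" "odd i" "i < length h"
  shows "h ! i = s (take i h)"
  using assms
proof (induction arbitrary: i)
  case (rascal h m)
  then have "i < length h"
    by (metis length_append_singleton less_SucE)
  then show ?case
    using rascal by (simp add: nth_append)
next
  case (gentle h)
  then show ?case
    by (cases "i = length h") (auto simp: nth_append)
qed simp

lemma histories_length_le:
  assumes "finite (pverts G)" "h \<in> histories G d s"
  shows "length h \<le> card (pverts G)"
  using histories_moves[OF assms(2)] assms(1) by (metis card_mono distinct_card length_map list.set_map)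

text \<open>Played vertices are distinct, so counting moves decides completeness. This turns parity
  of the length into information on free vertices.\<close>

lemma complete_iff_length:
  assumes "finite (pverts G)" "h \<in> histories G d s"
  shows "complete G h \<longleftrightarrow> length h = card (pverts G)"
proof -
  have *: "card (fst ` set h) = length h" "fst ` set h \<subseteq> pverts G"
    using histories_moves[OF assms(2)] by (metis distinct_card length_map list.set_map, blast)
  have "complete G h \<longleftrightarrow> fst ` set h = pverts G"
    using *(2) unfolding complete_def by blast
  then show ?thesis
    using card_subset_eq[OF assms(1) *(2)] *(1) by metis
qed

section \<open>Play within a single fiber\<close>

definition fiber :: "'b \<Rightarrow> ('a \<times> 'b) history \<Rightarrow> 'a history" where
  "fiber x h = map (\<lambda>((u, y), k). (u, k)) (filter (\<lambda>((u, y), k). y = x) h)"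

lemma fiber_Nil [simp]: "fiber x [] = []"
  by (simp add: fiber_def)

lemma fiber_snoc [simp]:
  "fiber x (h @ [((u, y), k)]) = (if y = x then fiber x h @ [(u, k)] else fiber x h)"
  by (simp add: fiber_def)

lemma fst_set_fiber: "fst ` set (fiber x h) = {u. (u, x) \<in> fst ` set h}"
  by (force simp: fiber_def)

lemma map_of_fiber: "map_of (fiber x h) u = map_of h (u, x)"
  by (induction h) (auto simp: fiber_def)

text \<open>The last move names the fiber to answer in. The unspecified \<open>last []\<close> is
  harmless: Gentle moves only after an odd number of moves.\<close>

definition fiberwise_strategy :: "('b \<Rightarrow> 'a strategy) \<Rightarrow> ('a \<times> 'b) strategy" where
  "fiberwise_strategy S h =
     (let x = snd (fst (last h)); m = S x (fiber x h) in ((fst m, x), snd m))"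

lemma legal_moves_cartesian_product_iff:
  "((u, x), k) \<in> legal_moves (H \<square> F) d h \<longleftrightarrow>
     x \<in> pverts F \<and> (u, k) \<in> legal_moves H d (fiber x h)"
  by (auto simp: legal_moves_def pverts_cartesian_product fst_set_fiber)

text \<open>The parity claim is the invariant that carries the induction: before each move of Rascal
  all fibers have even length, and after it just the fiber he played in is odd. So Rascal also moves
  first in every fiber.\<close>

lemma fiber_histories:
  assumes "h \<in> histories (H \<square> F) d (fiberwise_strategy S)"
  shows "fiber x h \<in> histories H d (S x) \<and>
    (odd (length (fiber x h)) \<longleftrightarrow> odd (length h) \<and> x = snd (fst (last h)))"
  using assms
proof (induction arbitrary: x)
  case start
  show ?case
    by (simp add: histories.start)
next
  case (rascal h m)
  obtain u y k where m: "m = ((u, y), k)"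
    by (metis prod.exhaust)
  have "(u, k) \<in> legal_moves H d (fiber y h)"
    using rascal.hyps(3) by (simp add: m legal_moves_cartesian_product_iff)
  then show ?case
    using rascal.IH[of x] rascal.IH[of y] rascal.hyps(2) by (auto simp: m intro: histories.rascal)
next
  case (gentle h)
  define y where "y = snd (fst (last h))"
  obtain u k where uk: "S y (fiber y h) = (u, k)"
    by fastforce
  have m: "fiberwise_strategy S h = ((u, y), k)"
    unfolding fiberwise_strategy_def y_def[symmetric] by (simp add: uk)
  have "fiber y h \<in> histories H d (S y)" "odd (length (fiber y h))"
    using gentle.IH[of y] gentle.hyps(2) by (simp_all add: y_def)
  moreover have "S y (fiber y h) \<in> legal_moves H d (fiber y h)"
    using gentle.hyps(3) by (simp add: m legal_moves_cartesian_product_iff uk)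
  ultimately have "fiber y h @ [(u, k)] \<in> histories H d (S y)"
    unfolding uk[symmetric] by (rule histories.gentle)
  then show ?case
    using gentle.IH[of x] gentle.hyps(2) by (auto simp: m y_def)
qed

lemma legal_fiberwise_strategy:
  assumes "finite (pverts H)" "even (card (pverts H))"
    and "\<And>x. x \<in> pverts F \<Longrightarrow> legal_strategy H d (S x)"
  shows "legal_strategy (H \<square> F) d (fiberwise_strategy S)"
  unfolding legal_strategy_def
proof (intro ballI impI)
  fix h
  assume h: "h \<in> histories (H \<square> F) d (fiberwise_strategy S)"
    and odd: "odd (length h) \<and> \<not> complete (H \<square> F) h"
  define x where "x = snd (fst (last h))"
  have fib: "fiber x h \<in> histories H d (S x)" "odd (length (fiber x h))"
    using fiber_histories[OF h, of x] odd by (auto simp: x_def)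
  have "last h \<in> set h"
    using odd by (intro last_in_set) auto
  then have x: "x \<in> pverts F"
    using histories_moves[OF h] by (force simp: x_def pverts_cartesian_product)
  \<comment> \<open>The fiber holds an odd number of moves but has an even number of
    vertices.\<close>
  have "\<not> complete H (fiber x h)"
    using complete_iff_length[OF assms(1) fib(1)] fib(2) assms(2) by auto
  then have "S x (fiber x h) \<in> legal_moves H d (fiber x h)"
    using assms(3)[OF x] fib by (auto simp: legal_strategy_def)
  then show "fiberwise_strategy S h \<in> legal_moves (H \<square> F) d h"
    using x unfolding fiberwise_strategy_def x_def[symmetric] Let_def
    by (simp add: legal_moves_cartesian_product_iff)
qed

lemma final_colorings_fiberwise_strategy:
  assumes "c \<in> final_colorings (H \<square> F) d (fiberwise_strategy S)" "x \<in> pverts F"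
  shows "(\<lambda>u. c (u, x)) \<in> final_colorings H d (S x)"
proof -
  obtain h where h: "c = (\<lambda>v. the (map_of h v))" "h \<in> histories (H \<square> F) d (fiberwise_strategy S)"
    "complete (H \<square> F) h"
    using assms(1) by (auto simp: final_colorings_def)
  have "fiber x h \<in> histories H d (S x)"
    using fiber_histories[OF h(2)] by blast
  moreover have "complete H (fiber x h)"
    using h(3) assms(2) unfolding complete_def fst_set_fiber
    by (auto simp: pverts_cartesian_product)
  ultimately show ?thesis
    unfolding final_colorings_def h(1) map_of_fiber[symmetric] by blast
qed

section \<open>Forcing a prescribed block-list\<close>

lemma block_type_solvable:
  assumes "d > 0" "t \<le> d div 2"
  shows "\<exists>b \<in> {1..d}. block_type d a b = t"
proof -
  \<comment> \<open>The color congruent to \<open>a - t\<close> modulo \<open>d\<close>. Subtracting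
    1 before the reduction and adding it afterwards moves the residues 0, ..., d - 1 to the colors
    1, ..., d.\<close>
  define b where "b = nat ((int a - int t - 1) mod int d) + 1"
  have b: "int b = (int a - int t - 1) mod int d + 1"
    using assms(1) by (simp add: b_def)
  have "(int a - int t - 1) mod int d < int d"
    using assms(1) by simp
  then have "b \<in> {1..d}"
    using b unfolding atLeastAtMost_iff by (intro conjI) (simp add: b_def, linarith)
  moreover have "(int a - int b) mod int d = (int a - (int a - int t - 1 + 1)) mod int d"
    unfolding b by (metis mod_add_left_eq mod_diff_right_eq)
  then have "(int a - int b) mod int d = int t"
    using assms by simp
  then have "block_type d a b = t"
    using assms(2) by (simp add: block_type_def Let_def)
  ultimately show ?thesis
    by blast
qed

text \<open>Gentle answers in the block in which Rascal has just played; the \<open>j\<close>-th block to be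
  completed receives the type \<open>T ! j\<close>.\<close>

definition pairing_strategy :: "('a \<Rightarrow> 'a) \<Rightarrow> nat \<Rightarrow> nat list \<Rightarrow> 'a strategy" where
  "pairing_strategy bar d T h = (bar (fst (last h)),
     SOME k. k \<in> {1..d} \<and> block_type d (snd (last h)) k = T ! (length h div 2))"

context
  fixes H :: "'a pair_pre_digraph" and bar :: "'a \<Rightarrow> 'a" and d :: nat and T :: "nat list"
  assumes finite_pverts: "finite (pverts H)"
    and bar: "\<And>u. u \<in> pverts H \<Longrightarrow> bar u \<in> pverts H \<and> bar (bar u) = u \<and> bar u \<noteq> u"
    and d_pos: "d > 0"
    and length_T: "2 * length T = card (pverts H)"
    and T_le: "set T \<subseteq> {..d div 2}"
begin

lemma pairing_strategy_color:
  assumes "length h div 2 < length T"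
  shows "snd (pairing_strategy bar d T h) \<in> {1..d} \<and>
    block_type d (snd (last h)) (snd (pairing_strategy bar d T h)) = T ! (length h div 2)"
proof -
  have "T ! (length h div 2) \<le> d div 2"
    using T_le assms nth_mem by blast
  from someI_ex[OF block_type_solvable[OF d_pos this, unfolded Bex_def]]
  show ?thesis
    by (simp add: pairing_strategy_def)
qed

lemma pairing_strategy_block:
  assumes "h \<in> histories H d (pairing_strategy bar d T)" "2 * j + 1 < length h"
  shows "fst (h ! (2 * j + 1)) = bar (fst (h ! (2 * j)))"
    and "block_type d (snd (h ! (2 * j))) (snd (h ! (2 * j + 1))) = T ! j"
proof -
  \<comment> \<open>The history that Gentle sees at her answer. Its length is
    \<open>2 * j + 1\<close>, so half of it, rounded down, is the block index
    \<open>j\<close>.\<close>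
  define g where "g = take (2 * j + 1) h"
  have g: "length g div 2 = j" "last g = h ! (2 * j)"
    using assms(2) by (simp_all add: g_def take_Suc_conv_app_nth)
  have eq: "h ! (2 * j + 1) = pairing_strategy bar d T g"
    using histories_nth_odd[OF assms(1) _ assms(2)] by (simp add: g_def)
  have "j < length T"
    using histories_length_le[OF finite_pverts assms(1)] assms(2) length_T by linarith
  then show "block_type d (snd (h ! (2 * j))) (snd (h ! (2 * j + 1))) = T ! j"
    using pairing_strategy_color[of g] unfolding eq g by simp
  show "fst (h ! (2 * j + 1)) = bar (fst (h ! (2 * j)))"
    unfolding eq by (simp add: pairing_strategy_def g)
qed

text \<open>All moves before Rascal's last one fill whole blocks. If the partner of his vertex were
  taken, his vertex would have been taken with it.\<close>

lemma legal_pairing_strategy: "legal_strategy H d (pairing_strategy bar d T)"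
  unfolding legal_strategy_def
proof (intro ballI impI)
  fix h
  assume h: "h \<in> histories H d (pairing_strategy bar d T)"
    and odd: "odd (length h) \<and> \<not> complete H h"
  then obtain j where j: "length h = 2 * j + 1"
    by (auto elim: oddE)
  have "length h < card (pverts H)"
    using histories_length_le[OF finite_pverts h] complete_iff_length[OF finite_pverts h] odd by simp
  then have jT: "length h div 2 < length T"
    using j length_T by simp
  define u where "u = fst (last h)"
  have last: "last h = h ! (2 * j)"
    using j by (metis add_diff_cancel_right' last_conv_nth list.size(3) odd even_zero)
  have dist: "distinct (map fst h)" and sub: "fst ` set h \<subseteq> pverts H"
    using histories_moves[OF h] by auto
  have nth_mem': "fst (h ! i) \<in> pverts H" if "i < length h" for i
    using sub that nth_mem by blast
  have nth_inj: "i = k" if "i < length h" "k < length h" "fst (h ! i) = fst (h ! k)" for i k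
    using dist that by (simp add: distinct_conv_nth) blast
  have u: "u \<in> pverts H" "u = fst (h ! (2 * j))"
    using nth_mem'[of "2 * j"] j by (simp_all add: u_def last)
  have "bar u \<notin> fst ` set h"
  proof
    assume "bar u \<in> fst ` set h"
    then obtain i where i: "i < length h" "bar u = fst (h ! i)"
      by (auto simp: in_set_conv_nth)
    have "i \<noteq> 2 * j"
      using i(2) u bar by metis
    show False
    proof (cases "even i")
      \<comment> \<open>Rascal played \<open>bar u\<close> earlier, so Gentle's reply at
        \<open>2 * k + 1\<close> was already \<open>u\<close>. The reply exists because
        \<open>i\<close> is not the last position.\<close>
      case True
      then obtain k where k: "i = 2 * k"
        by (elim evenE)
      have lt: "2 * k + 1 < length h"
        using i(1) \<open>i \<noteq> 2 * j\<close> j k by simp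
      have "fst (h ! (2 * k + 1)) = bar (bar u)"
        using pairing_strategy_block(1)[OF h lt] i(2) by (simp add: k)
      also have "\<dots> = fst (h ! (2 * j))"
        using bar u by simp
      finally have "2 * k + 1 = 2 * j"
        using nth_inj lt j by simp
      then show False
        by presburger
    next
      \<comment> \<open>Gentle played \<open>bar u\<close> in reply to an earlier move on
        \<open>u\<close>.\<close>
      case False
      then obtain k where k: "i = 2 * k + 1"
        by (elim oddE)
      have "bar u = bar (fst (h ! (2 * k)))"
        using pairing_strategy_block(1)[OF h] i by (simp add: k)
      then have "u = fst (h ! (2 * k))"
        using bar u(1) nth_mem'[of "2 * k"] i(1) k by (metis add_lessD1)
      then have "2 * k = 2 * j"
        using nth_inj[of "2 * k" "2 * j"] u(2) i(1) j k by simp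
      then show False
        using i(1) j k by simp
    qed
  qed
  then show "pairing_strategy bar d T h \<in> legal_moves H d h"
    using pairing_strategy_color[OF jT] bar u(1)
    by (simp add: legal_moves_def mem_Times_iff pairing_strategy_def u_def)
qed

lemma block_list_pairing_strategy:
  assumes "c \<in> final_colorings H d (pairing_strategy bar d T)"
  shows "block_list H bar d c = map (count_list T) [0..<d div 2 + 1]"
proof -
  obtain h where c: "c = (\<lambda>v. the (map_of h v))"
    and h: "h \<in> histories H d (pairing_strategy bar d T)" and complete: "complete H h"
    using assms by (auto simp: final_colorings_def)
  have len: "length h = 2 * length T"
    using complete_iff_length[OF finite_pverts h] complete length_T by simp
  have dist: "distinct (map fst h)" and verts: "fst ` set h = pverts H"
    using histories_moves[OF h] complete by (auto simp: complete_def)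
  define e where "e i = fst (h ! i)" for i
  have c_e: "c (e i) = snd (h ! i)" if "i < length h" for i
  proof -
    have "map_of h (e i) = Some (snd (h ! i))"
      using dist that by (simp add: e_def)
    then show ?thesis
      by (simp add: c)
  qed
  have e_inj: "i = k" if "i < length h" "k < length h" "e i = e k" for i k
    using dist that by (simp add: distinct_conv_nth e_def) blast
  have e_mem: "e i \<in> pverts H" if "i < length h" for i
    using verts that nth_mem unfolding e_def by blast
  have e_bar: "e (2 * j + 1) = bar (e (2 * j))" if "j < length T" for j
    using pairing_strategy_block(1)[OF h, of j] that len by (simp add: e_def)
  have e_type: "block_type d (c (e (2 * j))) (c (e (2 * j + 1))) = T ! j" if "j < length T" for j
    using pairing_strategy_block(2)[OF h, of j] c_e[of "2 * j"] c_e[of "2 * j + 1"] that len by simp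
  \<comment> \<open>The \<open>j\<close>-th block to be completed. Indexing blocks by completion
    reduces the count of blocks of type \<open>i\<close> to the count of \<open>i\<close> in
    \<open>T\<close>.\<close>
  define g where "g j = {e (2 * j), e (2 * j + 1)}" for j
  have "card {{u, bar u} | u. u \<in> pverts H \<and> block_type d (c u) (c (bar u)) = i} =
      count_list T i" for i
  proof -
    have "inj_on g {j. j < length T \<and> i = T ! j}"
    proof (rule inj_onI)
      fix j k
      assume jk: "j \<in> {j. j < length T \<and> i = T ! j}" "k \<in> {j. j < length T \<and> i = T ! j}" "g j = g k"
      then have "e (2 * j) = e (2 * k) \<or> e (2 * j) = e (2 * k + 1)"
        by (auto simp: g_def doubleton_eq_iff)
      then have "2 * j = 2 * k \<or> 2 * j = 2 * k + 1"
        using e_inj[of "2 * j" "2 * k"] e_inj[of "2 * j" "2 * k + 1"] jk(1,2) len by auto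
      then show "j = k"
        by presburger
    qed
    moreover have "{{u, bar u} | u. u \<in> pverts H \<and> block_type d (c u) (c (bar u)) = i} =
        g ` {j. j < length T \<and> i = T ! j}"
    proof (intro equalityI subsetI)
      fix b
      assume "b \<in> {{u, bar u} | u. u \<in> pverts H \<and> block_type d (c u) (c (bar u)) = i}"
      then obtain u where u: "u \<in> pverts H" "b = {u, bar u}" "block_type d (c u) (c (bar u)) = i"
        by blast
      then obtain n where n: "n < length h" "u = e n"
        unfolding verts[symmetric] e_def by (auto simp: in_set_conv_nth)
      define j where "j = n div 2"
      have j: "j < length T"
        using n(1) len by (simp add: j_def)
      have "n = 2 * j \<or> n = 2 * j + 1"
        unfolding j_def by presburger
      then have "b = g j \<and> i = T ! j"
      proof
        assume "n = 2 * j"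
        then show ?thesis
          using u n(2) e_bar[OF j] e_type[OF j] by (simp add: g_def)
      next
        \<comment> \<open>Here \<open>u\<close> is Gentle's vertex, so the block is read in reverse
          order and the symmetry of \<open>block_type\<close> is needed.\<close>
        assume "n = 2 * j + 1"
        then have "u = bar (e (2 * j))" "bar u = e (2 * j)"
          using n(2) e_bar[OF j] bar[OF e_mem[of "2 * j"]] j len by auto
        then show ?thesis
          using u(2,3) e_bar[OF j] e_type[OF j] block_type_commute[OF d_pos]
          by (auto simp: g_def)
      qed
      then show "b \<in> g ` {j. j < length T \<and> i = T ! j}"
        using j by blast
    next
      fix b
      assume "b \<in> g ` {j. j < length T \<and> i = T ! j}"
      then obtain j where j: "j < length T" "i = T ! j" "b = g j"
        by blast
      then have "b = {e (2 * j), bar (e (2 * j))}"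
        "block_type d (c (e (2 * j))) (c (bar (e (2 * j)))) = i"
        using e_bar[OF j(1)] e_type[OF j(1)] by (simp_all add: g_def)
      moreover have "e (2 * j) \<in> pverts H"
        using e_mem j(1) len by simp
      ultimately show "b \<in> {{u, bar u} | u. u \<in> pverts H \<and> block_type d (c u) (c (bar u)) = i}"
        by blast
    qed
    ultimately show ?thesis
      by (simp add: card_image count_list_eq_length_filter length_filter_conv_card)
  qed
  then show ?thesis
    by (simp add: block_list_def)
qed

end

lemma count_list_concat_replicate:
  assumes "distinct xs"
  shows "count_list (concat (map (\<lambda>i. replicate (f i) i) xs)) k = (if k \<in> set xs then f k else 0)"
proof -
  have "count_list (replicate n x) y = (if x = y then n else 0)" for n and x y :: 'a
    by (induction n) auto
  then show ?thesis
    using assms by (induction xs) auto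
qed

text \<open>Repeat each \<open>i\<close> exactly \<open>l ! i\<close> times. With the pairing
  strategy, every list of counts summing to the number of blocks is thus a reachable
  block-list.\<close>

lemma exists_list_with_counts:
  assumes "length l = m"
  obtains T where "length T = sum_list l" "set T \<subseteq> {..<m}" "map (count_list T) [0..<m] = l"
proof
  let ?T = "concat (map (\<lambda>i. replicate (l ! i) i) [0..<m])"
  show "length ?T = sum_list l"
    using map_nth[of l] assms by (simp add: length_concat comp_def)
  show "set ?T \<subseteq> {..<m}"
    by auto
  show "map (count_list ?T) [0..<m] = l"
    using assms by (intro nth_equalityI) (simp_all add: count_list_concat_replicate)
qed

text \<open>Since \<sigma> commutes with \<open>bar\<close>, it permutes the blocks and keeps their
  types. Two colorings occur because \<sigma> will compare the colorings of two different
  fibers.\<close>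

lemma block_list_automorphism:
  assumes "involutive H bar" "graph_automorphism H \<sigma>"
    and "\<And>u. u \<in> pverts H \<Longrightarrow> c' (\<sigma> u) = c u"
  shows "block_list H bar d c' = block_list H bar d c"
proof -
  have \<sigma>: "inj_on \<sigma> (pverts H)" "\<sigma> ` pverts H = pverts H"
    using graph_isomorphism_inj_on graph_isomorphism_image assms(2) by blast+
  have bar: "bar u \<in> pverts H" "\<sigma> (bar u) = bar (\<sigma> u)" if "u \<in> pverts H" for u
    using assms(1,2) that by (auto simp: involutive_def)
  let ?B = "\<lambda>c i. {{u, bar u} | u. u \<in> pverts H \<and> block_type d (c u) (c (bar u)) = i}"
  have "card (?B c' i) = card (?B c i)" for i
  proof -
    have "?B c' i = image \<sigma> ` ?B c i"
    proof (intro equalityI subsetI)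
      fix b assume "b \<in> ?B c' i"
      then obtain v where v: "v \<in> pverts H" "b = {v, bar v}" "block_type d (c' v) (c' (bar v)) = i"
        by blast
      then obtain u where u: "u \<in> pverts H" "v = \<sigma> u"
        using \<sigma>(2) by blast
      have "b = \<sigma> ` {u, bar u}"
        using v u bar by simp
      moreover have "block_type d (c u) (c (bar u)) = i"
        using v(3) assms(3)[OF u(1)] assms(3)[OF bar(1)[OF u(1)]] bar(2)[OF u(1)] u(2) by simp
      ultimately show "b \<in> image \<sigma> ` ?B c i"
        using u(1) by blast
    next
      fix b assume "b \<in> image \<sigma> ` ?B c i"
      then obtain u where u: "u \<in> pverts H" "b = \<sigma> ` {u, bar u}" "block_type d (c u) (c (bar u)) = i"
        by blast
      have "b = {\<sigma> u, bar (\<sigma> u)}" "block_type d (c' (\<sigma> u)) (c' (bar (\<sigma> u))) = i" "\<sigma> u \<in> pverts H"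
        using u assms(3)[OF u(1)] assms(3)[OF bar(1)[OF u(1)]] bar(2)[OF u(1)] \<sigma>(2) by auto
      then show "b \<in> ?B c' i"
        by blast
    qed
    moreover have "inj_on (image \<sigma>) (?B c i)"
      by (rule inj_on_subset[OF inj_on_image_Pow[OF \<sigma>(1)]]) (use bar(1) in auto)
    ultimately show ?thesis
      by (simp add: card_image)
  qed
  then show ?thesis
    unfolding block_list_def by simp
qed

text \<open>The minimum is attained once some distinguishing coloring exists; giving all vertices
  different colors is one.\<close>

lemma distinguishing_number_coloring:
  assumes "finite (pverts G)"
  obtains c where "c ` pverts G \<subseteq> {1..distinguishing_number G}" "distinguishing G c"
proof -
  obtain f where f: "bij_betw f (pverts G) {1..card (pverts G)}"
    using assms by (metis bij_betw_iff_card card_atLeastAtMost diff_Suc_1 finite_atLeastAtMost)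
  have "distinguishing G f"
    unfolding distinguishing_def
  proof (intro allI impI ballI)
    fix \<sigma> v
    assume "graph_automorphism G \<sigma> \<and> (\<forall>v \<in> pverts G. f (\<sigma> v) = f v)" "v \<in> pverts G"
    then show "\<sigma> v = v"
      using f graph_isomorphism_in_pverts by (metis bij_betw_def inj_onD)
  qed
  then have "\<exists>d c. c ` pverts G \<subseteq> {1..d} \<and> distinguishing G c"
    using f by (metis bij_betw_def order_refl)
  then have "\<exists>c. c ` pverts G \<subseteq> {1..distinguishing_number G} \<and> distinguishing G c"
    unfolding distinguishing_number_def by (rule LeastI_ex)
  then show ?thesis
    using that by blast
qed

lemma rascal_game_number_pos: "rascal_game_number G > 0"
proof -
  have "1 \<le> rascal_game_number G"
    unfolding rascal_game_number_def
    by (rule Inf_greatest) (auto simp: one_enat_def)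
  then show ?thesis
    by (metis not_one_le_zero not_gr_zero)
qed

lemma rascal_game_number_le:
  "d > 0 \<Longrightarrow> winning_strategy G d s \<Longrightarrow> rascal_game_number G \<le> enat d"
  unfolding rascal_game_number_def by (rule Inf_lower) blast

section \<open>Combining the fibers into a winning strategy\<close>

theorem theorem4p1:
  fixes H :: "'a pair_pre_digraph" and F :: "'b pair_pre_digraph"
    and bar :: "'a \<Rightarrow> 'a" and d :: nat and s :: "'a strategy" and L :: "nat list set"
  assumes "pair_graph H" and "Digraph_Component.connected (with_proj H)" and "involutive H bar"
    and "rascal_game_number H \<le> enat d"
    and "winning_strategy H d s"
    and "\<And>c. c \<in> final_colorings H d s \<Longrightarrow> block_list H bar d c \<in> L"
    and "finite L"
    and "pair_graph F" and "Digraph_Component.connected (with_proj F)" and "relatively_prime H F"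
    and "int (distinguishing_number F)
           \<le> int ((card (pverts H) div 2 + d div 2) choose (d div 2)) - int (card L) + 1"
  shows "rascal_game_number (H \<square> F) \<le> enat d"
proof -
  have connected: "connected_graph H" "connected_graph F"
    using assms connected_graphI by auto
  have fin: "finite (pverts H)" "finite (pverts F)"
    using assms by (simp_all add: pair_graph_iff)
  \<comment> \<open>The definition of the game number admits positive numbers of colors
    only.\<close>
  have d: "d > 0"
    using assms(4) rascal_game_number_pos[of H] by (cases d) (auto simp: zero_enat_def)
  have bar: "bar u \<in> pverts H \<and> bar (bar u) = u \<and> bar u \<noteq> u" if "u \<in> pverts H" for u
    using assms(3) that by (auto simp: involutive_def)
  have even: "even (card (pverts H))"
    using even_card_involution[OF fin(1) bar] .
  \<comment> \<open>\<open>N\<close> blocks, with types 0, ..., \<open>m\<close>.\<close>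
  define N m where "N = card (pverts H) div 2" and "m = d div 2"
  define D where "D = distinguishing_number F"
  obtain c0 where c0: "c0 ` pverts F \<subseteq> {1..D}" "distinguishing F c0"
    unfolding D_def using distinguishing_number_coloring[OF fin(2)] .
  obtain x0 where x0: "x0 \<in> pverts F"
    using connected(2) by (auto simp: connected_graph_def)
  \<comment> \<open>All candidate block-lists: the weak compositions of \<open>N\<close> into
    \<open>m + 1\<close> parts, counted by stars and bars.\<close>
  define B where "B = {l :: nat list. length l = m + 1 \<and> sum_list l = N}"
  have card_B: "card B = (N + m) choose m"
    unfolding B_def card_length_sum_list using binomial_symmetric[of N "N + m"] by simp
  then have "finite B"
    by (intro card_ge_0_finite) simp
  have "card ({1..D} - {c0 x0}) = D - 1"
    using c0(1) x0 by (subst card_Diff_singleton) auto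
  \<comment> \<open>Over the integers the subtraction of \<open>card L\<close> is not truncated. It
    follows that \<open>D - 1\<close> is at most \<open>card (B - L)\<close>, whether or not
    \<open>L\<close> lies in \<open>B\<close>.\<close>
  moreover have "int D \<le> int (card B) - int (card L) + 1"
    using assms(11) by (simp add: card_B D_def N_def m_def)
  then have "D - 1 \<le> card (B - L)"
    using diff_card_le_card_Diff[OF assms(7), of B] by linarith
  \<comment> \<open>The color of \<open>x0\<close> is the chosen class, played by \<open>s\<close>.
    Each of the other \<open>D - 1\<close> colors gets its own block-list outside
    \<open>L\<close>.\<close>
  ultimately obtain g where g: "inj_on g ({1..D} - {c0 x0})" "g ` ({1..D} - {c0 x0}) \<subseteq> B - L"
    using \<open>finite B\<close> card_le_inj[of "{1..D} - {c0 x0}" "B - L"] by auto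
  have "\<exists>T. length T = N \<and> set T \<subseteq> {..<m + 1} \<and> map (count_list T) [0..<m + 1] = l" if "l \<in> B" for l
    using that exists_list_with_counts[of l "m + 1"] unfolding B_def by blast
  then obtain T where T: "\<And>l. l \<in> B \<Longrightarrow>
      length (T l) = N \<and> set (T l) \<subseteq> {..<m + 1} \<and> map (count_list (T l)) [0..<m + 1] = l"
    by metis
  have T_ok: "2 * length (T l) = card (pverts H)" "set (T l) \<subseteq> {..d div 2}"
    "map (count_list (T l)) [0..<d div 2 + 1] = l" if "l \<in> B" for l
    using T[OF that] even by (auto simp: N_def m_def)
  have g_B: "g (c0 x) \<in> B" "g (c0 x) \<notin> L" if "x \<in> pverts F" "c0 x \<noteq> c0 x0" for x
    using g(2) c0(1) that by auto
  define S where "S x = (if c0 x = c0 x0 then s else pairing_strategy bar d (T (g (c0 x))))" for x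
  have "winning_strategy (H \<square> F) d (fiberwise_strategy S)"
    unfolding winning_strategy_iff
  proof (intro conjI ballI)
    have "legal_strategy H d (S x)" if "x \<in> pverts F" for x
      using assms(5) legal_pairing_strategy[OF fin(1) bar d] T_ok[OF g_B(1)] that
      by (simp add: S_def winning_strategy_iff)
    then show "legal_strategy (H \<square> F) d (fiberwise_strategy S)"
      using legal_fiberwise_strategy[OF fin(1) even] by blast
  next
    fix c
    assume c: "c \<in> final_colorings (H \<square> F) d (fiberwise_strategy S)"
    define cf where "cf x u = c (u, x)" for x u
    have cf: "cf x \<in> final_colorings H d (S x)" if "x \<in> pverts F" for x
      using final_colorings_fiberwise_strategy[OF c that] by (simp add: cf_def[abs_def])
    have special: "block_list H bar d (cf x) \<in> L" if "x \<in> pverts F" "c0 x = c0 x0" for x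
      using assms(6) cf[OF that(1)] that(2) by (simp add: S_def)
    have other: "block_list H bar d (cf x) = g (c0 x)" if "x \<in> pverts F" "c0 x \<noteq> c0 x0" for x
    proof -
      note ok = T_ok[OF g_B(1)[OF that]]
      have "cf x \<in> final_colorings H d (pairing_strategy bar d (T (g (c0 x))))"
        using cf[OF that(1)] that(2) by (simp add: S_def)
      from block_list_pairing_strategy[OF fin(1) bar d ok(1,2) this] show ?thesis
        unfolding ok(3) .
    qed
    \<comment> \<open>Block-lists recover the color: those in \<open>L\<close> come from the chosen
      class, and the others determine it because \<open>g\<close> is injective.\<close>
    have c0_eq: "c0 x = c0 y"
      if "x \<in> pverts F" "y \<in> pverts F" "block_list H bar d (cf x) = block_list H bar d (cf y)" for x y
    proof (cases "c0 x = c0 x0 \<or> c0 y = c0 x0")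
      case True
      then show ?thesis
        using special other g_B(2) that by metis
    next
      case False
      then have "g (c0 x) = g (c0 y)"
        using other that by auto
      then show ?thesis
        using inj_onD[OF g(1)] c0(1) that(1,2) False by blast
    qed
    show "distinguishing (H \<square> F) c"
      unfolding distinguishing_def
    proof (intro allI impI ballI)
      fix \<phi> v
      assume \<phi>: "graph_automorphism (H \<square> F) \<phi> \<and> (\<forall>v \<in> pverts (H \<square> F). c (\<phi> v) = c v)"
        and v: "v \<in> pverts (H \<square> F)"
      obtain \<sigma> \<tau> where \<sigma>: "graph_automorphism H \<sigma>" and \<tau>: "graph_automorphism F \<tau>"
        and eq: "\<And>u x. u \<in> pverts H \<Longrightarrow> x \<in> pverts F \<Longrightarrow> \<phi> (u, x) = (\<sigma> u, \<tau> x)"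
        using automorphism_cartesian_product[OF connected assms(10)] \<phi> by metis
      have cf_\<phi>: "cf (\<tau> x) (\<sigma> u) = cf x u" if "u \<in> pverts H" "x \<in> pverts F" for u x
        using \<phi> eq[OF that] that unfolding cf_def pverts_cartesian_product by (metis SigmaI)
      \<comment> \<open>\<sigma> carries the coloring over \<open>x\<close> to the one over
        \<open>\<tau> x\<close>, so both fibers have the same block-list.\<close>
      have "c0 (\<tau> x) = c0 x" if "x \<in> pverts F" for x
        using c0_eq graph_isomorphism_in_pverts[OF \<tau>] that
          block_list_automorphism[OF assms(3) \<sigma>, of "cf (\<tau> x)" "cf x"] cf_\<phi> by blast
      then have \<tau>_id: "\<tau> x = x" if "x \<in> pverts F" for x
        using c0(2) \<tau> that by (auto simp: distinguishing_def)
      \<comment> \<open>The fiber over \<open>x0\<close> is played by the winning strategy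
        \<open>s\<close>, and \<tau> fixes \<open>x0\<close>, so \<sigma> preserves a distinguishing
        coloring of \<open>H\<close>.\<close>
      have "distinguishing H (cf x0)"
        using assms(5) cf[OF x0] by (simp add: winning_strategy_iff S_def)
      moreover have "cf x0 (\<sigma> u) = cf x0 u" if "u \<in> pverts H" for u
        using cf_\<phi>[OF that x0] \<tau>_id[OF x0] by simp
      ultimately have "\<sigma> u = u" if "u \<in> pverts H" for u
        using \<sigma> that unfolding distinguishing_def by blast
      then show "\<phi> v = v"
        using v eq \<tau>_id by (auto simp: pverts_cartesian_product)
    qed
  qed
  then show ?thesis
    using rascal_game_number_le d by blast
qed

end
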